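(* Let $1<p<\infty$ and let $T\in\mathcal L(\ell_p)$. Then $$\operatorname{Int}W_e(T)\subset W(T).$$ Moreover, for every $\lambda\in\operatorname{Int}W_e(T)$ and every integer $k\ge0$ there exists a unit vector $x\in\ell_p$ with $\operatorname{supp}x\subset\{k+1,k+2,\dots\}$ and $\langle Tx,J(x)\rangle=\lambda$.
   Context: $\ell_p=\ell_p(\mathbb N)$, $\mathbb N=\{1,2,\dots\}$, is the complex sequence space and $\mathcal L(\ell_p)$ its algebra of bounded linear operators; $\operatorname{Int}$ denotes the interior in $\mathbb C$ and $\operatorname{supp}x=\{j:x_j\ne0\}$. With $1/p+1/q=1$, the dual $(\ell_p)^*$ is identified with $\ell_q$ via $\langle x,y\rangle=\sum_j x_j\overline{y_j}$. For $x=(x_j)\in\ell_p$ put $J(x)=(x_j|x_j|^{p-2})_j\in\ell_q$ (with $0$ in the coordinates where $x_j=0$). The numerical range is $W(T)=\{\langle Tx,J(x)\rangle:\ x\in\ell_p,\ \|x\|_p=1\}$. The essential numerical range $W_e(T)$ is the set of all $\lambda\in\mathbb C$ for which there is a net (equivalently, a sequence) of unit vectors $x_\alpha\in\ell_p$ with $x_\alpha\to0$ weakly and $\langle Tx_\alpha,J(x_\alpha)\rangle\to\lambda$. *)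

theory Defs
  imports "HOL-Analysis.Analysis"
begin

(* Sequences are functions on nat, so that the coordinates are numbered from 0:
   the coordinate x_j of the mathematical text (j = 1, 2, ...) is x (j - 1), and an index
   set {k+1, k+2, ...} there is {k..} here. *)

definition lp :: "real \<Rightarrow> (nat \<Rightarrow> complex) set" where
  "lp p = {x. summable (\<lambda>j. cmod (x j) powr p)}"

definition lp_norm :: "real \<Rightarrow> (nat \<Rightarrow> complex) \<Rightarrow> real" where
  "lp_norm p x = (\<Sum>j. cmod (x j) powr p) powr (1 / p)"

(* Operators are total functions on sequences; only their restriction to lp p is relevant. *)

definition lp_operators :: "real \<Rightarrow> ((nat \<Rightarrow> complex) \<Rightarrow> nat \<Rightarrow> complex) set" where
  "lp_operators p = {T.
     (\<forall>x\<in>lp p. T x \<in> lp p) \<and>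
     (\<forall>x\<in>lp p. \<forall>y\<in>lp p. T (\<lambda>j. x j + y j) = (\<lambda>j. T x j + T y j)) \<and>
     (\<forall>c. \<forall>x\<in>lp p. T (\<lambda>j. c * x j) = (\<lambda>j. c * T x j)) \<and>
     (\<exists>C. \<forall>x\<in>lp p. lp_norm p (T x) \<le> C * lp_norm p x)}"

definition pairing :: "(nat \<Rightarrow> complex) \<Rightarrow> (nat \<Rightarrow> complex) \<Rightarrow> complex" where
  "pairing x y = (\<Sum>j. x j * cnj (y j))"

definition duality_map :: "real \<Rightarrow> (nat \<Rightarrow> complex) \<Rightarrow> nat \<Rightarrow> complex" where
  "duality_map p x = (\<lambda>j. x j * of_real (cmod (x j) powr (p - 2)))"

definition supp :: "(nat \<Rightarrow> complex) \<Rightarrow> nat set" where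
  "supp x = {j. x j \<noteq> 0}"

definition numerical_range ::
  "real \<Rightarrow> ((nat \<Rightarrow> complex) \<Rightarrow> nat \<Rightarrow> complex) \<Rightarrow> complex set" where
  "numerical_range p T = {pairing (T x) (duality_map p x) |x. x \<in> lp p \<and> lp_norm p x = 1}"

(* The dual of lp p is identified, through the pairing, with lp q for 1/p + 1/q = 1,
   that is, q = p / (p - 1). *)

definition weakly_null :: "real \<Rightarrow> (nat \<Rightarrow> nat \<Rightarrow> complex) \<Rightarrow> bool" where
  "weakly_null p X \<longleftrightarrow> (\<forall>y\<in>lp (p / (p - 1)). (\<lambda>n. pairing (X n) y) \<longlonglongrightarrow> 0)"

definition essential_numerical_range ::
  "real \<Rightarrow> ((nat \<Rightarrow> complex) \<Rightarrow> nat \<Rightarrow> complex) \<Rightarrow> complex set" where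
  "essential_numerical_range p T = {z. \<exists>X.
     (\<forall>n. X n \<in> lp p \<and> lp_norm p (X n) = 1) \<and>
     weakly_null p X \<and>
     (\<lambda>n. pairing (T (X n)) (duality_map p (X n))) \<longlonglongrightarrow> z}"

end

theory Submission imports Defs begin

text \<open>
  Write \<open>J\<close> for the duality map and \<open>B(x, y) = \<langle>Tx, J(y)\<rangle> - z \<langle>x, J(y)\<rangle>\<close>. An interior point \<open>z\<close> of the
  essential numerical range is attained because it is already attained, exactly and not only in the
  limit, on combinations of three finitely supported vectors.

  If \<open>z + w\<close> is an essential value, then a weakly null sequence that realizes it can be truncated at
  both ends (\<open>essential_value_finite_support\<close>): arbitrarily far out there are finitely supported
  vectors \<open>v\<close> with \<open>B(v, v)\<close> close to \<open>w\<close>. Against a fixed vector, \<open>B\<close> becomes negligible in either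
  argument when the other one moves out to infinity (\<open>form_left_small_on_tails\<close>,
  \<open>form_right_small_on_tails\<close>). Hence, for finitely many \<open>w i\<close>, there are blocks \<open>v i\<close> with disjoint
  supports for which the matrix \<open>B(v i, v j)\<close> is almost diagonal with diagonal \<open>w i\<close>
  (\<open>almost_diagonal_block_vectors\<close>).

  On disjoint blocks \<open>J\<close> is additive, so for nonnegative numbers \<open>t i\<close> of sum 1 the vector
  \<open>x = \<Sum>i. t i powr (1 / p) * v i\<close> satisfies \<open>B(x, x) = (\<Sum>i. t i * w i) + error\<close> with a small error that
  depends continuously on \<open>t\<close>. As \<open>z\<close> is an interior point, three numbers \<open>w i\<close> can be taken as the
  vertices of a triangle around 0. A continuous map of the triangle that is uniformly close to the
  identity takes the value 0, by Brouwer's theorem (\<open>isotropic_vector\<close>). The resulting \<open>x \<noteq> 0\<close> with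
  \<open>B(x, x) = 0\<close> is normalized, and its support lies as far out as desired.
\<close>

section \<open>The sequence spaces\<close>

lemma lp_norm_nonneg [simp]: "0 \<le> lp_norm p x"
  by (simp add: lp_norm_def)

lemma lp_norm_powr:
  assumes "0 < p" "x \<in> lp p"
  shows "lp_norm p x powr p = (\<Sum>j. cmod (x j) powr p)"
proof -
  have "0 \<le> (\<Sum>j. cmod (x j) powr p)"
    using assms by (intro suminf_nonneg) (auto simp: lp_def)
  then show ?thesis using assms by (simp add: lp_norm_def powr_powr)
qed

lemma lp_dominated:
  assumes "0 < p" "x \<in> lp p" "\<And>j. cmod (y j) \<le> cmod (x j)"
  shows "y \<in> lp p" and "lp_norm p y \<le> lp_norm p x"
proof -
  have le: "cmod (y j) powr p \<le> cmod (x j) powr p" for j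
    using assms by (intro powr_mono2) auto
  then show y: "y \<in> lp p"
    using assms(2) unfolding lp_def by (auto intro: summable_comparison_test')
  have "(\<Sum>j. cmod (y j) powr p) \<le> (\<Sum>j. cmod (x j) powr p)"
    using le y assms(2) by (intro suminf_le) (auto simp: lp_def)
  moreover have "0 \<le> (\<Sum>j. cmod (y j) powr p)"
    using y by (intro suminf_nonneg) (auto simp: lp_def)
  ultimately show "lp_norm p y \<le> lp_norm p x"
    using assms(1) by (simp add: lp_norm_def powr_mono2)
qed

lemma lp_finite_support:
  assumes "finite (supp x)"
  shows "x \<in> lp p"
  using summable_finite[OF assms, of "\<lambda>j. cmod (x j) powr p"] by (auto simp: lp_def supp_def)

lemma lp_norm_eq_0_iff:
  assumes "0 < p" "x \<in> lp p"
  shows "lp_norm p x = 0 \<longleftrightarrow> (\<forall>j. x j = 0)"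
proof -
  have "lp_norm p x = 0 \<longleftrightarrow> (\<Sum>j. cmod (x j) powr p) = 0"
    by (auto simp: lp_norm_def)
  also have "\<dots> \<longleftrightarrow> (\<forall>j. cmod (x j) powr p = 0)"
    using assms by (intro suminf_eq_zero_iff) (auto simp: lp_def)
  finally show ?thesis by simp
qed

lemma lp_scale:
  assumes "x \<in> lp p"
  shows "(\<lambda>j. c * x j) \<in> lp p"
  using assms by (auto simp: lp_def norm_mult powr_mult intro: summable_mult)

lemma lp_norm_scale:
  assumes "0 < p" "x \<in> lp p"
  shows "lp_norm p (\<lambda>j. c * x j) = cmod c * lp_norm p x"
proof -
  have "(\<Sum>j. cmod (c * x j) powr p) = cmod c powr p * (\<Sum>j. cmod (x j) powr p)"
    using assms(2) by (simp add: lp_def norm_mult powr_mult suminf_mult)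
  then show ?thesis using assms
    by (simp add: lp_norm_def powr_mult powr_powr suminf_nonneg lp_def)
qed

text \<open>
  Each coordinate of a sum is at most twice the larger of the two coordinates; this crude
  bound is enough for closure under addition.
\<close>

lemma lp_add:
  assumes "0 < p" "x \<in> lp p" "y \<in> lp p"
  shows "(\<lambda>j. x j + y j) \<in> lp p"
proof -
  have "cmod (x j + y j) powr p \<le> 2 powr p * (cmod (x j) powr p + cmod (y j) powr p)" for j
  proof -
    have "cmod (x j + y j) \<le> 2 * max (cmod (x j)) (cmod (y j))"
      using norm_triangle_ineq[of "x j" "y j"] by (auto simp: max_def)
    then have "cmod (x j + y j) powr p \<le> (2 * max (cmod (x j)) (cmod (y j))) powr p"
      using assms by (intro powr_mono2) auto
    also have "\<dots> = 2 powr p * max (cmod (x j)) (cmod (y j)) powr p"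
      by (simp add: powr_mult)
    also have "\<dots> \<le> 2 powr p * (cmod (x j) powr p + cmod (y j) powr p)"
      by (intro mult_left_mono) (auto simp: max_def)
    finally show ?thesis .
  qed
  then show ?thesis
    using assms unfolding lp_def
    by (auto intro!: summable_comparison_test'[where N = 0
          and g = "\<lambda>j. 2 powr p * (cmod (x j) powr p + cmod (y j) powr p)"]
          summable_mult summable_add)
qed

section \<open>Truncations\<close>

definition truncation :: "nat set \<Rightarrow> (nat \<Rightarrow> complex) \<Rightarrow> nat \<Rightarrow> complex" where
  "truncation A x = (\<lambda>j. if j \<in> A then x j else 0)"

lemma truncation_in_lp: "0 < p \<Longrightarrow> x \<in> lp p \<Longrightarrow> truncation A x \<in> lp p"
  by (rule lp_dominated(1)[of p x]) (auto simp: truncation_def)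

lemma lp_norm_truncation_le: "0 < p \<Longrightarrow> x \<in> lp p \<Longrightarrow> lp_norm p (truncation A x) \<le> lp_norm p x"
  by (rule lp_dominated(2)[of p x]) (auto simp: truncation_def)

lemma supp_truncation: "supp (truncation A x) \<subseteq> A"
  by (auto simp: supp_def truncation_def)

lemma truncation_supp: "supp x \<subseteq> A \<Longrightarrow> truncation A x = x"
  by (auto simp: truncation_def supp_def fun_eq_iff)

text \<open>
  The \<open>p\<close>-th power of the norm is additive over disjoint sets of coordinates. This replaces
  the triangle inequality wherever a vector is split into pieces.
\<close>

lemma lp_norm_truncation_Un:
  assumes "0 < p" "x \<in> lp p" "A \<inter> B = {}"
  shows "lp_norm p (truncation (A \<union> B) x) powr p = lp_norm p (truncation A x) powr p + lp_norm p (truncation B x) powr p"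
proof -
  have s: "summable (\<lambda>j. cmod (truncation C x j) powr p)" for C
    using truncation_in_lp[OF assms(1,2)] by (auto simp: lp_def)
  have "(\<Sum>j. cmod (truncation (A \<union> B) x j) powr p)
      = (\<Sum>j. cmod (truncation A x j) powr p + cmod (truncation B x j) powr p)"
    using assms(3) by (intro arg_cong[where f = suminf]) (auto simp: truncation_def fun_eq_iff)
  then show ?thesis
    using assms s by (simp add: lp_norm_powr truncation_in_lp suminf_add)
qed

lemma lp_norm_truncation_lessThan:
  assumes "0 < p" "x \<in> lp p"
  shows "lp_norm p (truncation {..<m} x) powr p = (\<Sum>j<m. cmod (x j) powr p)"
proof -
  have "(\<Sum>j. cmod (truncation {..<m} x j) powr p) = (\<Sum>j<m. cmod (truncation {..<m} x j) powr p)"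
    by (intro suminf_finite) (auto simp: truncation_def)
  then show ?thesis
    by (simp add: lp_norm_powr[OF assms(1) truncation_in_lp[OF assms]]) (simp add: truncation_def)
qed

lemma lp_norm_tail_tendsto_0:
  assumes "0 < p" "x \<in> lp p"
  shows "(\<lambda>m. lp_norm p (truncation {m..} x) powr p) \<longlonglongrightarrow> 0"
proof -
  have "lp_norm p (truncation {m..} x) powr p
      = (\<Sum>j. cmod (x j) powr p) - (\<Sum>j<m. cmod (x j) powr p)" for m
  proof -
    have "{..<m} \<union> {m..} = UNIV" "{..<m} \<inter> {m..} = {}" by auto
    then show ?thesis
      using lp_norm_truncation_Un[OF assms, of "{..<m}" "{m..}"] assms
      by (simp add: lp_norm_truncation_lessThan lp_norm_powr[symmetric] truncation_supp)
  qed
  moreover have "(\<lambda>m. (\<Sum>j. cmod (x j) powr p) - (\<Sum>j<m. cmod (x j) powr p)) \<longlonglongrightarrow> 0"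
    using assms summable_LIMSEQ[of "\<lambda>j. cmod (x j) powr p"]
    by (auto simp: lp_def intro!: tendsto_eq_intros)
  ultimately show ?thesis by simp
qed

lemma lp_norm_tail_small:
  assumes "0 < p" "x \<in> lp p" "0 < e"
  obtains m where "lp_norm p (truncation {m..} x) < e"
proof -
  have "eventually (\<lambda>m. lp_norm p (truncation {m..} x) powr p < e powr p) sequentially"
    using lp_norm_tail_tendsto_0[OF assms(1,2)] assms(3) by (intro order_tendstoD(2)) auto
  then obtain m where "lp_norm p (truncation {m..} x) powr p < e powr p"
    by (auto simp: eventually_sequentially)
  then have "lp_norm p (truncation {m..} x) < e"
    using assms by (meson linorder_not_less powr_mono2 less_imp_le)
  then show ?thesis using that by blast
qed

section \<open>Hoelder's inequality and the duality map\<close>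

locale conjugate_exponents =
  fixes p q :: real
  assumes p_gt_1: "1 < p" and q_eq: "q = p / (p - 1)"
begin

lemma p_pos: "0 < p" and q_gt_1: "1 < q" and q_pos: "0 < q"
  and inverse_sum: "1 / p + 1 / q = 1" and p_minus_1_mult_q: "(p - 1) * q = p"
  using p_gt_1 by (auto simp: q_eq field_simps)

text \<open>
  Representing functionals on \<^term>\<open>lp p\<close> uses the duality map of the conjugate exponent, so
  the facts below are needed with the two exponents exchanged.
\<close>

lemma swap: "conjugate_exponents q p"
  by unfold_locales (use p_gt_1 q_gt_1 in \<open>auto simp: q_eq field_simps\<close>)

text \<open>
  Young's inequality, applied in each coordinate and summed, settles unit vectors;
  general vectors reduce to this case by scaling.
\<close>

lemma Holder_unit:
  assumes "x \<in> lp p" "y \<in> lp q"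
  shows "summable (\<lambda>j. cmod (x j * cnj (y j)))"
    and "lp_norm p x = 1 \<Longrightarrow> lp_norm q y = 1 \<Longrightarrow> cmod (pairing x y) \<le> 1"
proof -
  have Y: "cmod (x j * cnj (y j)) \<le> cmod (x j) powr p / p + cmod (y j) powr q / q" for j
    using Youngs_inequality[OF p_gt_1 q_gt_1 inverse_sum, of "cmod (x j)" "cmod (y j)"]
    by (simp add: norm_mult)
  have sx: "summable (\<lambda>j. cmod (x j) powr p)" and sy: "summable (\<lambda>j. cmod (y j) powr q)"
    using assms by (auto simp: lp_def)
  have s: "summable (\<lambda>j. cmod (x j) powr p / p + cmod (y j) powr q / q)"
    using sx sy by (intro summable_add summable_divide)
  then show *: "summable (\<lambda>j. cmod (x j * cnj (y j)))"
    using Y by (intro summable_comparison_test'[OF s, of 0]) auto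
  assume 1: "lp_norm p x = 1" "lp_norm q y = 1"
  have "cmod (pairing x y) \<le> (\<Sum>j. cmod (x j * cnj (y j)))"
    unfolding pairing_def using * by (rule summable_norm)
  also have "\<dots> \<le> (\<Sum>j. cmod (x j) powr p / p + cmod (y j) powr q / q)"
    using Y * s by (intro suminf_le)
  also have "\<dots> = (\<Sum>j. cmod (x j) powr p) / p + (\<Sum>j. cmod (y j) powr q) / q"
    using sx sy by (simp add: suminf_add[symmetric] suminf_divide summable_divide)
  also have "\<dots> = 1"
    using 1 assms inverse_sum p_pos q_pos lp_norm_powr[of p x] lp_norm_powr[of q y] by simp
  finally show "cmod (pairing x y) \<le> 1" .
qed

lemma summable_pairing:
  assumes "x \<in> lp p" "y \<in> lp q"
  shows "summable (\<lambda>j. x j * cnj (y j))"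
  using Holder_unit(1)[OF assms] by (rule summable_norm_cancel)

lemma Holder:
  assumes x: "x \<in> lp p" and y: "y \<in> lp q"
  shows "cmod (pairing x y) \<le> lp_norm p x * lp_norm q y"
proof (cases "lp_norm p x = 0 \<or> lp_norm q y = 0")
  case True
  then have "(\<lambda>j. x j * cnj (y j)) = (\<lambda>j. 0)"
    using lp_norm_eq_0_iff[OF p_pos x] lp_norm_eq_0_iff[OF q_pos y] by auto
  then have "pairing x y = 0" unfolding pairing_def by (simp only: suminf_zero)
  then show ?thesis by simp
next
  case False
  define a where "a = lp_norm p x"
  define b where "b = lp_norm q y"
  have ab: "0 < a" "0 < b" using False by (auto simp: a_def b_def less_le)
  have "cmod (pairing (\<lambda>j. of_real (1/a) * x j) (\<lambda>j. of_real (1/b) * y j)) \<le> 1"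
    using ab by (intro Holder_unit(2) lp_scale x y)
      (simp_all only: lp_norm_scale[OF p_pos x] lp_norm_scale[OF q_pos y] norm_of_real,
        auto simp: a_def b_def)
  moreover have "pairing (\<lambda>j. of_real (1/a) * x j) (\<lambda>j. of_real (1/b) * y j)
      = (\<Sum>j. of_real (1 / (a * b)) * (x j * cnj (y j)))"
    unfolding pairing_def by (intro arg_cong[where f = suminf]) (auto simp: fun_eq_iff)
  moreover have "\<dots> = of_real (1 / (a * b)) * pairing x y"
    unfolding pairing_def using summable_pairing[OF x y] by (rule suminf_mult)
  ultimately have "cmod (of_real (1 / (a * b)) * pairing x y) \<le> 1" by simp
  then have "cmod (pairing x y) / (a * b) \<le> 1"
    using ab by (simp only: norm_mult norm_of_real) simp
  then show ?thesis using ab by (simp add: a_def b_def)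
qed

lemma cmod_duality_map: "cmod (duality_map p x j) = cmod (x j) powr (p - 1)"
proof (cases "x j = 0")
  case False
  then show ?thesis
    using powr_add[of "cmod (x j)" 1 "p - 2"] by (simp add: duality_map_def norm_mult)
qed (simp add: duality_map_def)

lemma cmod_duality_map_powr: "cmod (duality_map p x j) powr q = cmod (x j) powr p"
  by (simp add: cmod_duality_map powr_powr p_minus_1_mult_q)

lemma duality_map_in_lq: "x \<in> lp p \<Longrightarrow> duality_map p x \<in> lp q"
  by (simp add: lp_def cmod_duality_map_powr)

lemma lp_norm_duality_map:
  assumes "x \<in> lp p"
  shows "lp_norm q (duality_map p x) = lp_norm p x powr (p - 1)"
  using p_gt_1 by (simp add: lp_norm_def cmod_duality_map_powr powr_powr) (simp add: q_eq)

lemma mult_cnj_duality_map: "x j * cnj (duality_map p x j) = of_real (cmod (x j) powr p)"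
proof (cases "x j = 0")
  case False
  have "x j * cnj (duality_map p x j) = of_real ((cmod (x j))\<^sup>2 * cmod (x j) powr (p - 2))"
    by (simp add: duality_map_def complex_norm_square mult.assoc[symmetric] del: of_real_power)
  also have "(cmod (x j))\<^sup>2 * cmod (x j) powr (p - 2) = cmod (x j) powr p"
    using False powr_add[of "cmod (x j)" 2 "p - 2"] by (simp add: powr_numeral)
  finally show ?thesis .
qed simp

lemma pairing_duality_map:
  assumes "x \<in> lp p"
  shows "pairing x (duality_map p x) = of_real (lp_norm p x powr p)"
  using assms unfolding pairing_def mult_cnj_duality_map lp_norm_powr[OF p_pos assms]
  by (simp add: suminf_of_real lp_def)

lemma pairing_add_left:
  assumes "x \<in> lp p" "x' \<in> lp p" "y \<in> lp q"
  shows "pairing (\<lambda>j. x j + x' j) y = pairing x y + pairing x' y"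
  using suminf_add[OF summable_pairing[OF assms(1,3)] summable_pairing[OF assms(2,3)]]
  by (simp add: pairing_def distrib_right)

lemma pairing_add_right:
  assumes "x \<in> lp p" "y \<in> lp q" "y' \<in> lp q"
  shows "pairing x (\<lambda>j. y j + y' j) = pairing x y + pairing x y'"
  using suminf_add[OF summable_pairing[OF assms(1,2)] summable_pairing[OF assms(1,3)]]
  by (simp add: pairing_def distrib_left)

lemma pairing_scale_left:
  assumes "x \<in> lp p" "y \<in> lp q"
  shows "pairing (\<lambda>j. c * x j) y = c * pairing x y"
  using suminf_mult[OF summable_pairing[OF assms], of c] by (simp add: pairing_def mult.assoc)

lemma pairing_scale_right:
  assumes "x \<in> lp p" "y \<in> lp q"
  shows "pairing x (\<lambda>j. c * y j) = cnj c * pairing x y"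
  using suminf_mult[OF summable_pairing[OF assms], of "cnj c"]
  by (simp add: pairing_def mult.left_commute)

lemma duality_map_scale:
  assumes "0 \<le> c"
  shows "duality_map p (\<lambda>j. of_real c * x j) = (\<lambda>j. of_real (c powr (p - 1)) * duality_map p x j)"
proof (cases "c = 0")
  case False
  then have "c powr (p - 1) = c * c powr (p - 2)"
    using assms powr_add[of c 1 "p - 2"] by simp
  then show ?thesis using assms
    by (auto simp: duality_map_def norm_mult powr_mult)
qed (auto simp: duality_map_def)

text \<open>
  For \<open>p\<close> other than 2 the duality map is not additive, but a coordinate in which one summand
  vanishes causes no defect. This is why the vectors combined below have disjoint supports.
\<close>

lemma duality_map_add_disjoint:
  assumes "supp x \<inter> supp y = {}"
  shows "duality_map p (\<lambda>j. x j + y j) = (\<lambda>j. duality_map p x j + duality_map p y j)"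
proof
  fix j
  have "x j = 0 \<or> y j = 0" using assms by (auto simp: supp_def)
  then show "duality_map p (\<lambda>j. x j + y j) j = duality_map p x j + duality_map p y j"
    by (auto simp: duality_map_def)
qed

end

section \<open>Bounded functionals\<close>

lemma supp_scale: "supp (\<lambda>j. c * x j) \<subseteq> supp x"
  by (auto simp: supp_def)

lemma zero_in_lp: "(\<lambda>j. 0) \<in> lp p"
  by (simp add: lp_def)

lemma lp_sum:
  assumes "0 < p" "finite I" "\<And>i. i \<in> I \<Longrightarrow> v i \<in> lp p"
  shows "(\<lambda>j. \<Sum>i\<in>I. c i * v i j) \<in> lp p"
  using assms(2,3) by (induction I) (auto simp: zero_in_lp intro!: lp_add[OF assms(1)] lp_scale)

lemma lp_functional_sum:
  fixes \<phi> :: "(nat \<Rightarrow> complex) \<Rightarrow> complex"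
  assumes "0 < p"
    and add: "\<And>x y. x \<in> lp p \<Longrightarrow> y \<in> lp p \<Longrightarrow> \<phi> (\<lambda>j. x j + y j) = \<phi> x + \<phi> y"
    and scale: "\<And>c x. x \<in> lp p \<Longrightarrow> \<phi> (\<lambda>j. c * x j) = c * \<phi> x"
    and "finite I" "\<And>i. i \<in> I \<Longrightarrow> v i \<in> lp p"
  shows "\<phi> (\<lambda>j. \<Sum>i\<in>I. c i * v i j) = (\<Sum>i\<in>I. c i * \<phi> (v i))"
  using assms(4,5)
proof (induction I)
  case empty
  show ?case using scale[OF zero_in_lp, of 0] by simp
next
  case (insert i I)
  then show ?case
    using add[OF lp_scale[of "v i" p "c i"] lp_sum[OF assms(1), of I v c]] scale[of "v i" "c i"]
    by simp
qed

context conjugate_exponents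
begin

lemma pairing_truncation_left: "supp y \<subseteq> A \<Longrightarrow> pairing (truncation A x) y = pairing x y"
  unfolding pairing_def
  by (intro arg_cong[where f = suminf]) (auto simp: truncation_def supp_def fun_eq_iff)

lemma pairing_truncation_right: "supp x \<subseteq> A \<Longrightarrow> pairing x (truncation A y) = pairing x y"
  unfolding pairing_def
  by (intro arg_cong[where f = suminf]) (auto simp: truncation_def supp_def fun_eq_iff)

lemma supp_duality_map: "supp (duality_map p x) \<subseteq> supp x"
  by (auto simp: supp_def duality_map_def)

text \<open>
  The part of the duality between \<^term>\<open>lp p\<close> and \<^term>\<open>lp q\<close> that is needed: a bounded functional
  is given by its values \<open>cnj (g j)\<close> on the unit vectors, and these are \<open>q\<close>-summable. For
  the latter, evaluate the functional at the duality map of a truncation \<open>h\<close> of \<open>g\<close>: with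
  \<open>s\<close> the \<open>q\<close>-norm of \<open>h\<close>, the value is \<open>s powr q\<close> and the norm of the
  argument is \<open>s powr (q - 1)\<close>, hence \<open>s \<le> \<bar>K\<bar>\<close> independently of the truncation.
\<close>

lemma functional_representation:
  fixes \<phi> :: "(nat \<Rightarrow> complex) \<Rightarrow> complex"
  assumes add: "\<And>x y. x \<in> lp p \<Longrightarrow> y \<in> lp p \<Longrightarrow> \<phi> (\<lambda>j. x j + y j) = \<phi> x + \<phi> y"
    and scale: "\<And>c x. x \<in> lp p \<Longrightarrow> \<phi> (\<lambda>j. c * x j) = c * \<phi> x"
    and bound: "\<And>x. x \<in> lp p \<Longrightarrow> cmod (\<phi> x) \<le> K * lp_norm p x"
  obtains g where "g \<in> lp q" and "\<And>u. finite (supp u) \<Longrightarrow> \<phi> u = pairing u g"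
proof -
  interpret dual: conjugate_exponents q p by (rule swap)
  define e :: "nat \<Rightarrow> nat \<Rightarrow> complex" where "e i = (\<lambda>j. if j = i then 1 else 0)" for i
  define g where "g i = cnj (\<phi> (e i))" for i
  have e: "e i \<in> lp p" for i
    by (rule lp_finite_support, rule finite_subset[of _ "{i}"]) (auto simp: e_def supp_def)
  have repr: "\<phi> u = pairing u g" if "finite (supp u)" for u
  proof -
    have u: "u = (\<lambda>j. \<Sum>i\<in>supp u. u i * e i j)"
      using that by (auto simp: e_def supp_def fun_eq_iff if_distrib cong: if_cong)
    have "\<phi> u = (\<Sum>i\<in>supp u. u i * \<phi> (e i))"
      by (subst u, rule lp_functional_sum[OF p_pos add scale that e])
    also have "\<dots> = pairing u g"
      unfolding pairing_def using that by (subst suminf_finite[of "supp u"]) (auto simp: g_def supp_def)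
    finally show ?thesis .
  qed
  have "(\<Sum>j<N. cmod (g j) powr q) \<le> \<bar>K\<bar> powr q" for N
  proof -
    define h where "h = truncation {..<N} g"
    define s where "s = lp_norm q h"
    have fin: "finite (supp h)"
      using supp_truncation[of "{..<N}" g] finite_subset by (auto simp: h_def)
    then have h: "h \<in> lp q" by (rule lp_finite_support)
    have fin': "finite (supp (duality_map q h))"
      using fin dual.supp_duality_map finite_subset by blast
    have "supp (duality_map q h) \<subseteq> {..<N}"
      using dual.supp_duality_map[of h] supp_truncation[of "{..<N}" g] unfolding h_def by blast
    then have "\<phi> (duality_map q h) = pairing (duality_map q h) h"
      unfolding repr[OF fin'] by (simp add: h_def pairing_truncation_right)
    also have "\<dots> = (\<Sum>j. of_real (cmod (h j) powr q))"
      unfolding pairing_def using arg_cong[OF dual.mult_cnj_duality_map[of h], of cnj]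
      by (intro arg_cong[where f = suminf]) (auto simp: mult.commute)
    also have "\<dots> = of_real (s powr q)"
      using h by (simp add: s_def lp_norm_powr[OF q_pos] suminf_of_real lp_def)
    finally have "s powr q \<le> \<bar>K\<bar> * s powr (q - 1)"
      using bound[OF dual.duality_map_in_lq[OF h]] dual.lp_norm_duality_map[OF h]
        mult_right_mono[OF abs_ge_self[of K], of "s powr (q - 1)"]
      by (simp add: s_def)
    moreover have "s powr q = s * s powr (q - 1)"
      using powr_add[of s 1 "q - 1"] by (auto simp: s_def)
    ultimately have "s \<le> \<bar>K\<bar>"
      by (cases "s = 0") auto
    moreover have "s powr q = (\<Sum>j<N. cmod (g j) powr q)"
    proof -
      have "s powr q = (\<Sum>j. cmod (h j) powr q)"
        using lp_norm_powr[OF q_pos h] by (simp add: s_def)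
      also have "\<dots> = (\<Sum>j<N. cmod (h j) powr q)"
        by (intro suminf_finite) (auto simp: h_def truncation_def)
      finally show ?thesis by (simp add: h_def truncation_def)
    qed
    ultimately show ?thesis
      using powr_mono2[of q s "\<bar>K\<bar>"] q_pos by (simp add: s_def)
  qed
  then have "g \<in> lp q"
    unfolding lp_def by (auto intro!: summableI_nonneg_bounded)
  then show ?thesis using repr that by blast
qed

end

section \<open>The form of an operator\<close>

locale lp_operator = conjugate_exponents +
  fixes T :: "(nat \<Rightarrow> complex) \<Rightarrow> nat \<Rightarrow> complex" and z :: complex
  assumes T: "T \<in> lp_operators p"
begin

text \<open>
  On the diagonal, \<^term>\<open>form x x\<close> is \<open>\<langle>Tx, J(x)\<rangle> - z \<parallel>x\<parallel>\<^sup>p\<close>. It scales by a positive factor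
  when \<open>x\<close> is scaled by a positive number, so that a nonzero vector with \<^prop>\<open>form x x = 0\<close>
  becomes, after normalization, a unit vector at which \<open>z\<close> is attained. Hence the vectors of the
  construction have to be nonzero and of norm at most 1, but not unit vectors.
\<close>

definition form :: "(nat \<Rightarrow> complex) \<Rightarrow> (nat \<Rightarrow> complex) \<Rightarrow> complex" where
  "form x y = pairing (T x) (duality_map p y) - z * pairing x (duality_map p y)"

lemma T_in_lp: "x \<in> lp p \<Longrightarrow> T x \<in> lp p"
  and T_add: "x \<in> lp p \<Longrightarrow> y \<in> lp p \<Longrightarrow> T (\<lambda>j. x j + y j) = (\<lambda>j. T x j + T y j)"
  and T_scale: "x \<in> lp p \<Longrightarrow> T (\<lambda>j. c * x j) = (\<lambda>j. c * T x j)"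
  using T by (auto simp: lp_operators_def)

lemma form_bounded:
  obtains K where "0 \<le> K"
    and "\<And>x y. x \<in> lp p \<Longrightarrow> y \<in> lp p \<Longrightarrow>
      cmod (form x y) \<le> K * lp_norm p x * lp_norm p y powr (p - 1)"
proof -
  obtain C where C: "\<And>x. x \<in> lp p \<Longrightarrow> lp_norm p (T x) \<le> C * lp_norm p x"
    using T unfolding lp_operators_def mem_Collect_eq by blast
  have "cmod (form x y) \<le> (\<bar>C\<bar> + cmod z) * lp_norm p x * lp_norm p y powr (p - 1)"
    if x: "x \<in> lp p" and y: "y \<in> lp p" for x y
  proof -
    let ?n = "lp_norm p y powr (p - 1)"
    have "cmod (form x y) \<le> cmod (pairing (T x) (duality_map p y))
        + cmod z * cmod (pairing x (duality_map p y))"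
      unfolding form_def by (metis norm_triangle_ineq4 norm_mult)
    also have "\<dots> \<le> lp_norm p (T x) * ?n + cmod z * (lp_norm p x * ?n)"
      using Holder[OF T_in_lp[OF x] duality_map_in_lq[OF y]] Holder[OF x duality_map_in_lq[OF y]]
      by (intro add_mono mult_left_mono) (auto simp: lp_norm_duality_map[OF y])
    also have "lp_norm p (T x) \<le> \<bar>C\<bar> * lp_norm p x"
      using C[OF x] mult_right_mono[OF abs_ge_self[of C], of "lp_norm p x"] by simp
    finally show ?thesis by (simp add: algebra_simps mult_right_mono)
  qed
  then show ?thesis using that[of "\<bar>C\<bar> + cmod z"] by auto
qed

lemma form_add_left:
  assumes "x \<in> lp p" "x' \<in> lp p" "y \<in> lp p"
  shows "form (\<lambda>j. x j + x' j) y = form x y + form x' y"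
  using assms
  by (simp add: form_def T_add pairing_add_left T_in_lp duality_map_in_lq algebra_simps)

lemma form_scale_left:
  assumes "x \<in> lp p" "y \<in> lp p"
  shows "form (\<lambda>j. c * x j) y = c * form x y"
  using assms
  by (simp add: form_def T_scale pairing_scale_left T_in_lp duality_map_in_lq algebra_simps)

lemma form_add_right:
  assumes "x \<in> lp p" "y \<in> lp p" "y' \<in> lp p" "supp y \<inter> supp y' = {}"
  shows "form x (\<lambda>j. y j + y' j) = form x y + form x y'"
  using assms
  by (simp add: form_def duality_map_add_disjoint pairing_add_right T_in_lp duality_map_in_lq
      algebra_simps)

lemma form_scale_right:
  assumes "x \<in> lp p" "y \<in> lp p" "0 \<le> c"
  shows "form x (\<lambda>j. of_real c * y j) = of_real (c powr (p - 1)) * form x y"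
  using assms
  by (simp add: form_def duality_map_scale pairing_scale_right T_in_lp duality_map_in_lq
      right_diff_distrib)

lemma form_sum_right:
  assumes "finite I" "x \<in> lp p" "\<And>i. i \<in> I \<Longrightarrow> v i \<in> lp p" "\<And>i. i \<in> I \<Longrightarrow> 0 \<le> a i"
    and "\<And>i k. i \<in> I \<Longrightarrow> k \<in> I \<Longrightarrow> i \<noteq> k \<Longrightarrow> supp (v i) \<inter> supp (v k) = {}"
  shows "form x (\<lambda>j. \<Sum>i\<in>I. of_real (a i) * v i j)
      = (\<Sum>i\<in>I. of_real (a i powr (p - 1)) * form x (v i))"
  using assms(1,3-5)
proof (induction I)
  case empty
  show ?case by (simp add: form_def pairing_def duality_map_def)
next
  case (insert i I)
  have "supp (\<lambda>j. of_real (a i) * v i j) \<inter> supp (\<lambda>j. \<Sum>k\<in>I. of_real (a k) * v k j) = {}"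
  proof -
    have "(\<Sum>k\<in>I. of_real (a k) * v k j) = 0" if "j \<in> supp (v i)" for j
    proof (rule sum.neutral, rule ballI)
      fix k assume "k \<in> I"
      then have "j \<notin> supp (v k)" using insert.hyps(2) insert.prems(3)[of i k] that by auto
      then show "of_real (a k) * v k j = 0" by (simp add: supp_def)
    qed
    then show ?thesis by (auto simp: supp_def)
  qed
  then have "form x (\<lambda>j. of_real (a i) * v i j + (\<Sum>k\<in>I. of_real (a k) * v k j))
      = form x (\<lambda>j. of_real (a i) * v i j) + form x (\<lambda>j. \<Sum>k\<in>I. of_real (a k) * v k j)"
    using insert.hyps insert.prems(1)
    by (intro form_add_right assms(2) lp_scale lp_sum[OF p_pos]) auto
  then show ?case
    using insert by (simp add: form_scale_right assms(2))
qed

lemma form_sum: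
  assumes "finite I" "\<And>i. i \<in> I \<Longrightarrow> v i \<in> lp p" "\<And>i. i \<in> I \<Longrightarrow> 0 \<le> a i"
    and "\<And>i k. i \<in> I \<Longrightarrow> k \<in> I \<Longrightarrow> i \<noteq> k \<Longrightarrow> supp (v i) \<inter> supp (v k) = {}"
  shows "form (\<lambda>j. \<Sum>i\<in>I. of_real (a i) * v i j) (\<lambda>j. \<Sum>i\<in>I. of_real (a i) * v i j)
      = (\<Sum>i\<in>I. \<Sum>k\<in>I. of_real (a i * a k powr (p - 1)) * form (v i) (v k))"
proof -
  let ?x = "\<lambda>j. \<Sum>i\<in>I. of_real (a i) * v i j"
  have x: "?x \<in> lp p" by (rule lp_sum[OF p_pos assms(1,2)])
  have "form ?x ?x = (\<Sum>i\<in>I. of_real (a i) * form (v i) ?x)"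
    using lp_functional_sum[of p "\<lambda>u. form u ?x", OF p_pos _ _ assms(1,2)]
      form_add_left[OF _ _ x] form_scale_left[OF _ x] by simp
  also have "\<dots> = (\<Sum>i\<in>I. of_real (a i) *
      (\<Sum>k\<in>I. of_real (a k powr (p - 1)) * form (v i) (v k)))"
    using assms by (intro sum.cong refl arg_cong2[where f = "(*)"] form_sum_right) auto
  finally show ?thesis by (simp add: sum_distrib_left mult.assoc)
qed

text \<open>
  The map \<open>u \<mapsto> form u y\<close> is a bounded functional, so a sequence in \<^term>\<open>lp q\<close> represents it,
  and the tails of that sequence have small norm.
\<close>

lemma form_left_small_on_tails:
  assumes "y \<in> lp p" "0 < e"
  shows "eventually (\<lambda>m. \<forall>u. finite (supp u) \<longrightarrow> supp u \<subseteq> {m..} \<longrightarrow> lp_norm p u \<le> 1 \<longrightarrow>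
    cmod (form u y) \<le> e) sequentially"
proof -
  obtain K where K: "\<And>x. x \<in> lp p \<Longrightarrow>
      cmod (form x y) \<le> (K * lp_norm p y powr (p - 1)) * lp_norm p x"
    using form_bounded assms(1) by (metis mult.assoc mult.commute)
  obtain g where g: "g \<in> lp q" "\<And>u. finite (supp u) \<Longrightarrow> form u y = pairing u g"
    using functional_representation[of "\<lambda>u. form u y", OF form_add_left form_scale_left K]
      assms(1) by blast
  obtain m where m: "lp_norm q (truncation {m..} g) < e"
    using lp_norm_tail_small[OF q_pos g(1) assms(2)] .
  have "cmod (form u y) \<le> e"
    if u: "finite (supp u)" "supp u \<subseteq> {m'..}" "lp_norm p u \<le> 1" and "m \<le> m'" for u m'
  proof -
    have "form u y = pairing u (truncation {m..} g)"
      using g(2)[OF u(1)] pairing_truncation_right[of u "{m..}" g] u(2) \<open>m \<le> m'\<close>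
      by (force simp: subset_iff)
    then have "cmod (form u y) \<le> lp_norm p u * lp_norm q (truncation {m..} g)"
      using Holder[OF lp_finite_support[OF u(1)] truncation_in_lp[OF q_pos g(1)]] by simp
    also have "\<dots> \<le> 1 * e" using u m by (intro mult_mono) auto
    finally show ?thesis by simp
  qed
  then show ?thesis by (auto simp: eventually_sequentially)
qed

text \<open>
  In the second argument the form is in general not additive, but it is the pairing of the fixed vector
  \<open>T x - z x\<close> with the duality map of \<open>u\<close>, which lives on the support of \<open>u\<close>; only
  the tail of that vector matters.
\<close>

lemma form_right_small_on_tails:
  assumes "x \<in> lp p" "0 < e"
  shows "eventually (\<lambda>m. \<forall>u. finite (supp u) \<longrightarrow> supp u \<subseteq> {m..} \<longrightarrow> lp_norm p u \<le> 1 \<longrightarrow>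
    cmod (form x u) \<le> e) sequentially"
proof -
  define w where "w = (\<lambda>j. T x j + (- z) * x j)"
  have w: "w \<in> lp p"
    unfolding w_def using assms by (intro lp_add[OF p_pos] T_in_lp lp_scale)
  have form_w: "form x u = pairing w (duality_map p u)" if "u \<in> lp p" for u
    unfolding w_def form_def using assms that
    by (subst pairing_add_left) (auto simp: pairing_scale_left[of _ _ "- z", simplified]
        T_in_lp duality_map_in_lq lp_scale[of x p "- z", simplified])
  obtain m where m: "lp_norm p (truncation {m..} w) < e"
    using lp_norm_tail_small[OF p_pos w assms(2)] .
  have "cmod (form x u) \<le> e"
    if u: "finite (supp u)" "supp u \<subseteq> {m'..}" "lp_norm p u \<le> 1" and "m \<le> m'" for u m'
  proof -
    have u_lp: "u \<in> lp p" using u(1) by (rule lp_finite_support)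
    have "supp (duality_map p u) \<subseteq> {m..}"
      using supp_duality_map[of u] u(2) \<open>m \<le> m'\<close> by force
    then have "cmod (form x u) \<le> lp_norm p (truncation {m..} w) * lp_norm p u powr (p - 1)"
      using Holder[OF truncation_in_lp[OF p_pos w, of "{m..}"] duality_map_in_lq[OF u_lp]]
      by (simp add: form_w[OF u_lp] pairing_truncation_left lp_norm_duality_map[OF u_lp])
    also have "\<dots> \<le> e * 1"
      using u m p_gt_1 assms(2) by (intro mult_mono powr_le1) auto
    finally show ?thesis by simp
  qed
  then show ?thesis by (auto simp: eventually_sequentially)
qed

end

section \<open>Essential values on finite blocks\<close>

lemma weakly_null_coordinate:
  assumes "weakly_null p X"
  shows "(\<lambda>n. X n i) \<longlonglongrightarrow> 0"
proof -
  define e :: "nat \<Rightarrow> complex" where "e = (\<lambda>j. if j = i then 1 else 0)"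
  have "supp e = {i}" by (auto simp: e_def supp_def)
  then have "e \<in> lp (p / (p - 1))" by (intro lp_finite_support) simp
  moreover have "pairing (X n) e = X n i" for n
    unfolding pairing_def by (subst suminf_finite[of "{i}"]) (auto simp: e_def)
  ultimately show ?thesis using assms by (auto simp: weakly_null_def)
qed

context lp_operator
begin

text \<open>
  A weakly null sequence tends to zero in each coordinate, so a late member carries little mass
  on the first \<open>k\<close> coordinates, and it carries little mass far out as well. Cutting off both
  ends leaves a block \<open>v\<close> and a small remainder \<open>r\<close> with disjoint supports, and then
  \<open>form x x - form v v = form r x + form v r\<close>, which is of order \<open>h + h powr (p - 1)\<close>
  when \<open>r\<close> has norm below \<open>h\<close>.
\<close>

lemma essential_value_finite_support:
  assumes "z + w \<in> essential_numerical_range p T" and "0 < e"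
  obtains v M where "supp v \<subseteq> {k..<M}" "v \<noteq> (\<lambda>j. 0)" "lp_norm p v \<le> 1" "cmod (form v v - w) < e"
proof -
  obtain X where X: "\<And>n. X n \<in> lp p" "\<And>n. lp_norm p (X n) = 1"
    and wn: "weakly_null p X"
    and lim: "(\<lambda>n. pairing (T (X n)) (duality_map p (X n))) \<longlonglongrightarrow> z + w"
    using assms(1) by (auto simp: essential_numerical_range_def)
  obtain K where K: "0 \<le> K" "\<And>x y. x \<in> lp p \<Longrightarrow> y \<in> lp p \<Longrightarrow>
      cmod (form x y) \<le> K * lp_norm p x * lp_norm p y powr (p - 1)"
    using form_bounded by blast
  have "((\<lambda>h::real. K * (h + h powr (p - 1))) \<longlongrightarrow> K * (0 + 0 powr (p - 1))) (at_right 0)"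
    using p_gt_1 by (intro tendsto_intros) (auto intro: eventually_mono[OF eventually_at_right_less[of 0]])
  then have "eventually (\<lambda>h::real. K * (h + h powr (p - 1)) < e / 2) (at_right 0)"
    using assms(2) by (intro order_tendstoD(2)) auto
  moreover have "eventually (\<lambda>h::real. h < 1) (at_right 0)"
    by (rule order_tendstoD(2)[OF tendsto_ident_at]) simp
  ultimately have ev: "eventually (\<lambda>h::real. 0 < h \<and> h < 1 \<and> K * (h + h powr (p - 1)) < e / 2) (at_right 0)"
    using eventually_at_right_less[of "0::real"] by eventually_elim auto
  obtain h :: real where h: "0 < h" "h < 1" "K * (h + h powr (p - 1)) < e / 2"
    using eventually_happens'[OF trivial_limit_at_right_real ev] by blast
  have "(\<lambda>n. \<Sum>j<k. cmod (X n j) powr p) \<longlonglongrightarrow> (\<Sum>j<k. cmod 0 powr p)"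
    using p_pos weakly_null_coordinate[OF wn] by (intro tendsto_intros) auto
  then have "(\<lambda>n. lp_norm p (truncation {..<k} (X n)) powr p) \<longlonglongrightarrow> 0"
    by (simp add: lp_norm_truncation_lessThan[OF p_pos X(1)])
  then have "eventually (\<lambda>n. lp_norm p (truncation {..<k} (X n)) powr p < h powr p / 2) sequentially"
    using h by (intro order_tendstoD(2)) auto
  moreover have "(\<lambda>n. form (X n) (X n)) \<longlonglongrightarrow> w"
    using tendsto_diff[OF lim tendsto_const[of z]]
    by (simp add: form_def pairing_duality_map[OF X(1)] X(2))
  then have "eventually (\<lambda>n. cmod (form (X n) (X n) - w) < e / 2) sequentially"
    using assms(2) by (auto dest!: tendstoD[where e = "e / 2"] simp: dist_norm)
  ultimately have ev: "eventually (\<lambda>n. lp_norm p (truncation {..<k} (X n)) powr p < h powr p / 2 \<and>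
      cmod (form (X n) (X n) - w) < e / 2) sequentially"
    by (rule eventually_conj)
  obtain n where n: "lp_norm p (truncation {..<k} (X n)) powr p < h powr p / 2"
    "cmod (form (X n) (X n) - w) < e / 2"
    using eventually_happens'[OF sequentially_bot ev] by blast
  define x where "x = X n"
  have x: "x \<in> lp p" "lp_norm p x = 1" using X by (auto simp: x_def)
  have "eventually (\<lambda>m. lp_norm p (truncation {m..} x) powr p < h powr p / 2) sequentially"
    using h lp_norm_tail_tendsto_0[OF p_pos x(1)] by (intro order_tendstoD(2)) auto
  then have "eventually (\<lambda>m. lp_norm p (truncation {m..} x) powr p < h powr p / 2 \<and> k \<le> m) sequentially"
    using eventually_ge_at_top[of k] by eventually_elim auto
  then obtain M where M: "lp_norm p (truncation {M..} x) powr p < h powr p / 2" "k \<le> M"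
    by (auto simp: eventually_sequentially)
  define v where "v = truncation {k..<M} x"
  \<comment> \<open>Each of the two ends has mass below half of \<open>h powr p\<close>.\<close>
  define r where "r = truncation ({..<k} \<union> {M..}) x"
  have v: "v \<in> lp p" "lp_norm p v \<le> 1" and r: "r \<in> lp p"
    using truncation_in_lp[OF p_pos x(1)] lp_norm_truncation_le[OF p_pos x(1), of "{k..<M}"] x(2)
    by (auto simp: v_def r_def)
  have x_split: "x = (\<lambda>j. v j + r j)"
    by (auto simp: v_def r_def truncation_def fun_eq_iff)
  have disj: "supp v \<inter> supp r = {}"
    by (auto simp: v_def r_def truncation_def supp_def)
  have "lp_norm p r powr p = lp_norm p (truncation {..<k} x) powr p + lp_norm p (truncation {M..} x) powr p"
    unfolding r_def using M(2) by (intro lp_norm_truncation_Un p_pos x(1)) auto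
  also have "\<dots> < h powr p" using M n by (simp add: x_def)
  finally have rh: "lp_norm p r < h"
    using h p_pos by (meson linorder_not_less powr_mono2 less_imp_le)
  have "form x x - form v v = form r x + form v r"
  proof -
    have "form x x = form v x + form r x"
      using form_add_left[OF v(1) r x(1)] x_split by simp
    moreover have "form v x = form v v + form v r"
      using form_add_right[OF v(1) v(1) r disj] x_split by simp
    ultimately show ?thesis by simp
  qed
  also have "cmod \<dots> \<le> K * lp_norm p r * 1 + K * 1 * lp_norm p r powr (p - 1)"
  proof (rule order_trans[OF norm_triangle_ineq add_mono])
    show "cmod (form r x) \<le> K * lp_norm p r * 1"
      using K(2)[OF r x(1)] x(2) by simp
    have "cmod (form v r) \<le> K * lp_norm p v * lp_norm p r powr (p - 1)"
      by (rule K(2)[OF v(1) r])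
    also have "\<dots> \<le> K * 1 * lp_norm p r powr (p - 1)"
      using K(1) v(2) by (intro mult_right_mono mult_left_mono) auto
    finally show "cmod (form v r) \<le> K * 1 * lp_norm p r powr (p - 1)" .
  qed
  also have "\<dots> \<le> K * (h + h powr (p - 1))"
    using K(1) rh p_gt_1 powr_mono2[of "p - 1" "lp_norm p r" h]
    by (simp add: distrib_left[symmetric] mult_left_mono add_mono)
  finally have diff: "cmod (form x x - form v v) < e / 2" using h(3) by simp
  have "form v v - w = (form x x - w) - (form x x - form v v)" by simp
  then have "cmod (form v v - w) \<le> cmod (form x x - w) + cmod (form x x - form v v)"
    by (metis norm_triangle_ineq4)
  then have "cmod (form v v - w) < e" using n(2) diff by (simp add: x_def)
  moreover have "v \<noteq> (\<lambda>j. 0)"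
  proof
    assume "v = (\<lambda>j. 0)"
    then have "r = x" using x_split by auto
    then show False using rh x(2) h(2) by simp
  qed
  ultimately show ?thesis using that[of v M] v(2) supp_truncation[of "{k..<M}" x] by (simp add: v_def)
qed

text \<open>
  The common bound \<open>M\<close> on the supports shows from where on a further block can be placed.
\<close>

definition almost_diagonal ::
  "nat \<Rightarrow> nat \<Rightarrow> nat \<Rightarrow> (nat \<Rightarrow> complex) \<Rightarrow> real \<Rightarrow> (nat \<Rightarrow> nat \<Rightarrow> complex) \<Rightarrow> bool" where
  "almost_diagonal n k M w e v \<longleftrightarrow>
    (\<forall>i<n. supp (v i) \<subseteq> {k..<M} \<and> v i \<noteq> (\<lambda>j. 0) \<and> lp_norm p (v i) \<le> 1) \<and>
    (\<forall>i<n. \<forall>j<n. i \<noteq> j \<longrightarrow> supp (v i) \<inter> supp (v j) = {}) \<and>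
    (\<forall>i<n. \<forall>j<n. cmod (form (v i) (v j) - (if i = j then w i else 0)) \<le> e)"

text \<open>
  Blocks are chosen one after the other. Once some are fixed, both tail estimates make the
  interaction with them negligible for every vector supported sufficiently far out, and
  essential values can be realized arbitrarily far out.
\<close>

lemma almost_diagonal_block_vectors:
  assumes "\<And>i. i < n \<Longrightarrow> z + w i \<in> essential_numerical_range p T" and "0 < e"
  shows "\<exists>v M. almost_diagonal n k M w e v"
  using assms(1)
proof (induction n)
  case 0
  show ?case by (simp add: almost_diagonal_def)
next
  case (Suc n)
  then obtain v M where vM: "almost_diagonal n k M w e v"
    using less_SucI by blast
  then have
    v: "\<And>i. i < n \<Longrightarrow> supp (v i) \<subseteq> {k..<M} \<and> v i \<noteq> (\<lambda>j. 0) \<and> lp_norm p (v i) \<le> 1"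
    and disj: "\<And>i j. i < n \<Longrightarrow> j < n \<Longrightarrow> i \<noteq> j \<Longrightarrow> supp (v i) \<inter> supp (v j) = {}"
    and diag: "\<And>i j. i < n \<Longrightarrow> j < n \<Longrightarrow>
      cmod (form (v i) (v j) - (if i = j then w i else 0)) \<le> e"
    by (simp_all add: almost_diagonal_def)
  have vlp: "v i \<in> lp p" if "i < n" for i
    using v[OF that] finite_subset by (intro lp_finite_support) blast
  have "eventually (\<lambda>m. \<forall>i\<in>{..<n}. \<forall>u. finite (supp u) \<longrightarrow> supp u \<subseteq> {m..} \<longrightarrow>
      lp_norm p u \<le> 1 \<longrightarrow> cmod (form u (v i)) \<le> e) sequentially"
    using form_left_small_on_tails[OF vlp assms(2)] by (intro eventually_ball_finite) auto
  moreover have "eventually (\<lambda>m. \<forall>i\<in>{..<n}. \<forall>u. finite (supp u) \<longrightarrow> supp u \<subseteq> {m..} \<longrightarrow>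
      lp_norm p u \<le> 1 \<longrightarrow> cmod (form (v i) u) \<le> e) sequentially"
    using form_right_small_on_tails[OF vlp assms(2)] by (intro eventually_ball_finite) auto
  moreover have "eventually (\<lambda>m. max k M \<le> m) sequentially"
    by (rule eventually_ge_at_top)
  ultimately have "eventually (\<lambda>m. max k M \<le> m \<and> (\<forall>i<n. \<forall>u. finite (supp u) \<longrightarrow> supp u \<subseteq> {m..} \<longrightarrow>
      lp_norm p u \<le> 1 \<longrightarrow> cmod (form u (v i)) \<le> e \<and> cmod (form (v i) u) \<le> e)) sequentially"
    by eventually_elim auto
  then obtain m where m: "max k M \<le> m"
    and small: "\<And>i u. i < n \<Longrightarrow> finite (supp u) \<Longrightarrow> supp u \<subseteq> {m..} \<Longrightarrow> lp_norm p u \<le> 1 \<Longrightarrow>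
      cmod (form u (v i)) \<le> e \<and> cmod (form (v i) u) \<le> e"
    by (auto simp: eventually_sequentially)
  obtain u M' where u: "supp u \<subseteq> {m..<M'}" "u \<noteq> (\<lambda>j. 0)" "lp_norm p u \<le> 1"
    "cmod (form u u - w n) < e"
    using essential_value_finite_support[OF Suc.prems[of n] assms(2), of m] by auto
  have fin: "finite (supp u)" and sub: "supp u \<subseteq> {m..}"
    using u(1) finite_subset by auto
  define v' where "v' = v(n := u)"
  have v'_simps: "v' n = u" "\<And>i. i < n \<Longrightarrow> v' i = v i" by (auto simp: v'_def)
  have uv: "supp (v i) \<inter> supp u = {}" if "i < n" for i
    using v[OF that] sub m by fastforce
  have "supp (v' i) \<subseteq> {k..<max M M'} \<and> v' i \<noteq> (\<lambda>j. 0) \<and> lp_norm p (v' i) \<le> 1"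
    if "i < Suc n" for i
    using that v[of i] u m by (cases "i = n") (force simp: v'_simps less_Suc_eq)+
  moreover have "supp (v' i) \<inter> supp (v' j) = {}" if "i < Suc n" "j < Suc n" "i \<noteq> j" for i j
    using that disj[of i j] uv[of i] uv[of j]
    by (cases "i = n"; cases "j = n") (simp_all add: v'_simps less_Suc_eq Int_commute)
  moreover have "cmod (form (v' i) (v' j) - (if i = j then w i else 0)) \<le> e"
    if "i < Suc n" "j < Suc n" for i j
    using that diag small[OF _ fin sub u(3)] u(4)
    by (cases "i = n"; cases "j = n") (auto simp: v'_simps less_Suc_eq)
  ultimately have "almost_diagonal (Suc n) k (max M M') w e v'"
    by (simp add: almost_diagonal_def)
  then show ?case by blast
qed

section \<open>Attaining interior points\<close>

text \<open>
  Take three points \<open>w i\<close> of a triangle around 0 and almost diagonal blocks \<open>v i\<close> for them.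
  If \<open>t i \<zeta>\<close> are the barycentric coordinates of \<open>\<zeta>\<close> in the triangle, then the
  combination of the blocks with coefficients \<open>t i \<zeta> powr (1 / p)\<close> has as its form value
  \<open>F \<zeta> = \<zeta> + error\<close>, with an error that is small uniformly in \<open>\<zeta>\<close>. Thus \<open>\<zeta> - F \<zeta>\<close>
  maps a small disc around 0 into itself, and its Brouwer fixed point is a zero of \<open>F\<close>.
\<close>

lemma isotropic_vector:
  assumes "cball z d \<subseteq> essential_numerical_range p T" and "0 < d"
  obtains x where "finite (supp x)" "supp x \<subseteq> {k..}" "x \<noteq> (\<lambda>j. 0)" "form x x = 0"
proof -
  \<comment> \<open>The point \<open>- R - R \<i>\<close> used below has modulus \<open>sqrt 2 * R\<close>; halving \<open>d\<close> keeps it in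
    the disc of radius \<open>d\<close>.\<close>
  define R where "R = d / 2"
  have R: "0 < R" using assms(2) by (simp add: R_def)
  then have R27: "0 < R / 27" by simp
  define w :: "nat \<Rightarrow> complex" where
    "w i = (if i = 0 then Complex R 0 else if i = 1 then Complex 0 R else Complex (- R) (- R))" for i
  have "cmod (w i) \<le> d" for i
    using cmod_le[of "w i"] R by (auto simp: w_def R_def)
  then have "z + w i \<in> essential_numerical_range p T" for i
    using assms(1) by (auto simp: dist_norm)
  then obtain v M where vM: "almost_diagonal 3 k M w (R / 27) v"
    using almost_diagonal_block_vectors[OF _ R27] by blast
  then have
    v: "\<And>i. i < 3 \<Longrightarrow> supp (v i) \<subseteq> {k..<M} \<and> v i \<noteq> (\<lambda>j. 0) \<and> lp_norm p (v i) \<le> 1"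
    and disj: "\<And>i j. i < 3 \<Longrightarrow> j < 3 \<Longrightarrow> i \<noteq> j \<Longrightarrow> supp (v i) \<inter> supp (v j) = {}"
    and diag: "\<And>i j. i < (3::nat) \<Longrightarrow> j < 3 \<Longrightarrow>
      cmod (form (v i) (v j) - (if i = j then w i else 0)) \<le> R / 27"
    by (simp_all add: almost_diagonal_def)
  have vlp: "v i \<in> lp p" if "i < 3" for i
    using v[OF that] finite_subset by (intro lp_finite_support) blast
  \<comment> \<open>Barycentric coordinates with respect to \<open>R\<close>, \<open>R \<i>\<close> and \<open>- R - R \<i>\<close>; they stay
    nonnegative on the disc of radius \<open>R / 3\<close>.\<close>
  define t :: "nat \<Rightarrow> complex \<Rightarrow> real" where
    "t i \<zeta> = (1 + (if i = 0 then 2 * Re \<zeta> - Im \<zeta> else if i = 1 then 2 * Im \<zeta> - Re \<zeta>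
      else - Re \<zeta> - Im \<zeta>) / R) / 3" for i \<zeta>
  have t_sum: "(\<Sum>i<3. t i \<zeta>) = 1" for \<zeta>
    using R by (simp add: t_def eval_nat_numeral lessThan_Suc divide_simps)
  have t_bary: "(\<Sum>i<3. of_real (t i \<zeta>) * w i) = \<zeta>" for \<zeta>
    using R by (simp add: t_def w_def eval_nat_numeral lessThan_Suc complex_eq_iff field_simps)
  have t_range: "0 \<le> t i \<zeta> \<and> t i \<zeta> \<le> 1" if "\<zeta> \<in> cball 0 (R / 3)" for i \<zeta>
  proof -
    have "\<bar>Re \<zeta>\<bar> \<le> R / 3" "\<bar>Im \<zeta>\<bar> \<le> R / 3"
      using that abs_Re_le_cmod[of \<zeta>] abs_Im_le_cmod[of \<zeta>] by (auto simp: dist_norm)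
    then show ?thesis
      using R by (auto simp: t_def field_simps abs_le_iff)
  qed
  have t_cont: "continuous_on S (t i)" for S i
    unfolding t_def by (cases "i = 0"; cases "i = 1") (auto intro!: continuous_intros simp: R[THEN less_imp_neq, symmetric])
  \<comment> \<open>The second exponent is \<open>(p - 1) / p\<close>: the coefficients enter through the duality map with
    the power \<open>p - 1\<close>.\<close>
  define c where "c i j \<zeta> = t i \<zeta> powr (1 / p) * t j \<zeta> powr (1 / q)" for i j \<zeta>
  define F where "F \<zeta> = (\<Sum>i<3. \<Sum>j<3. of_real (c i j \<zeta>) * form (v i) (v j))" for \<zeta>
  have c_diag: "c i i \<zeta> = t i \<zeta>" if "\<zeta> \<in> cball 0 (R / 3)" for i \<zeta>
    using t_range[OF that, of i] inverse_sum by (simp add: c_def powr_add[symmetric])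
  have c_range: "\<bar>c i j \<zeta>\<bar> \<le> 1" if "\<zeta> \<in> cball 0 (R / 3)" for i j \<zeta>
    using t_range[OF that, of i] t_range[OF that, of j] p_pos q_pos
    by (auto simp: c_def abs_mult intro!: mult_le_one powr_le1)
  have near: "cmod (\<zeta> - F \<zeta>) \<le> R / 3" if \<zeta>: "\<zeta> \<in> cball 0 (R / 3)" for \<zeta>
  proof -
    have "\<zeta> = (\<Sum>i<3. \<Sum>j<3. of_real (c i j \<zeta>) * (if i = j then w i else 0))"
      using t_bary[of \<zeta>] by (simp add: if_distrib sum.delta c_diag[OF \<zeta>] cong: if_cong)
    then have "\<zeta> - F \<zeta> = (\<Sum>i<3. \<Sum>j<3. of_real (c i j \<zeta>) * (if i = j then w i else 0)) - F \<zeta>"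
      by simp
    also have "\<dots> = - (\<Sum>i<3. \<Sum>j<3. of_real (c i j \<zeta>) *
        (form (v i) (v j) - (if i = j then w i else 0)))"
      by (simp add: F_def sum_subtractf right_diff_distrib)
    \<comment> \<open>Nine entries, each with an error of at most \<open>R / 27\<close>.\<close>
    also have "cmod \<dots> \<le> (\<Sum>i<(3::nat). \<Sum>j<(3::nat). R / 27)"
      unfolding norm_minus_cancel
    proof (intro sum_norm_le)
      fix i j :: nat assume "i \<in> {..<3}" "j \<in> {..<3}"
      then show "cmod (of_real (c i j \<zeta>) * (form (v i) (v j) - (if i = j then w i else 0))) \<le> R / 27"
        using mult_mono[OF c_range[OF \<zeta>, of i j] diag[of i j]] by (simp add: norm_mult)
    qed
    finally show ?thesis by simp
  qed
  have "continuous_on (cball 0 (R / 3)) (\<lambda>\<zeta>. \<zeta> - F \<zeta>)"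
    unfolding F_def c_def using t_range p_pos q_pos
    by (intro continuous_intros continuous_on_powr' t_cont) auto
  moreover have "(\<lambda>\<zeta>. \<zeta> - F \<zeta>) \<in> cball 0 (R / 3) \<rightarrow> cball 0 (R / 3)"
    using near by (simp add: Pi_iff)
  ultimately obtain \<zeta> where \<zeta>: "\<zeta> \<in> cball 0 (R / 3)" and "\<zeta> - F \<zeta> = \<zeta>"
    using brouwer_ball[of "R / 3" "0::complex" "\<lambda>\<zeta>. \<zeta> - F \<zeta>"] R by auto
  then have F0: "F \<zeta> = 0" by simp
  define a where "a i = t i \<zeta> powr (1 / p)" for i
  define x where "x = (\<lambda>j. \<Sum>i<3. of_real (a i) * v i j)"
  have "form x x = (\<Sum>i<3. \<Sum>j<3. of_real (a i * a j powr (p - 1)) * form (v i) (v j))"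
    unfolding x_def using vlp disj by (intro form_sum) (auto simp: a_def)
  also have "\<dots> = F \<zeta>"
    using p_gt_1 by (simp add: F_def c_def a_def powr_powr q_eq)
  finally have "form x x = 0" using F0 by simp
  moreover have supp_x: "supp x \<subseteq> {k..<M}"
  proof
    fix j assume "j \<in> supp x"
    then obtain i where "i < 3" "v i j \<noteq> 0"
      unfolding supp_def x_def by (auto elim!: sum.not_neutral_contains_not_neutral)
    then show "j \<in> {k..<M}" using v[of i] by (auto simp: supp_def)
  qed
  moreover have "x \<noteq> (\<lambda>j. 0)"
  proof -
    obtain i where i: "i < 3" "t i \<zeta> \<noteq> 0"
      using t_sum[of \<zeta>] by (metis lessThan_iff sum.neutral zero_neq_one)
    obtain j where j: "v i j \<noteq> 0" using v[OF i(1)] by auto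
    have "v l j = 0" if "l < 3" "l \<noteq> i" for l
      using disj[OF i(1) that(1)] that j by (auto simp: supp_def)
    then have "x j = of_real (a i) * v i j"
      unfolding x_def using i(1) by (subst sum.remove[of _ i]) (auto intro!: sum.neutral)
    then have "x j \<noteq> 0" using i j t_range[OF \<zeta>, of i] by (simp add: a_def)
    then show ?thesis by auto
  qed
  ultimately show ?thesis
    using that[of x] finite_subset[OF supp_x] by force
qed

lemma normalised_attaining_vector:
  assumes x: "x \<in> lp p" "x \<noteq> (\<lambda>j. 0)" and "form x x = 0"
  obtains y where "y \<in> lp p" "lp_norm p y = 1" "supp y \<subseteq> supp x"
    "pairing (T y) (duality_map p y) = z"
proof -
  define s where "s = 1 / lp_norm p x"
  have pos: "0 < lp_norm p x"
    using lp_norm_eq_0_iff[OF p_pos x(1)] x(2) by (auto simp: less_le)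
  have s: "0 < s" using pos by (simp add: s_def)
  define y where "y = (\<lambda>j. of_real s * x j)"
  have y: "y \<in> lp p" unfolding y_def by (rule lp_scale[OF x(1)])
  have norm: "lp_norm p y = 1"
    unfolding y_def lp_norm_scale[OF p_pos x(1)] using pos by (simp add: s_def norm_divide)
  have "form y y = of_real s * (of_real (s powr (p - 1)) * form x x)"
    unfolding y_def using x(1) s
    by (simp add: form_scale_left form_scale_right lp_scale)
  then have "pairing (T y) (duality_map p y) = z"
    using assms(3) by (simp add: form_def pairing_duality_map[OF y] norm)
  then show ?thesis using that[OF y norm] supp_scale[of "of_real s" x] by (simp add: y_def)
qed

end

theorem theorem3p17:
  fixes p :: real and T :: "(nat \<Rightarrow> complex) \<Rightarrow> nat \<Rightarrow> complex"
  assumes "1 < p" and "T \<in> lp_operators p"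
  shows "interior (essential_numerical_range p T) \<subseteq> numerical_range p T \<and>
    (\<forall>z \<in> interior (essential_numerical_range p T). \<forall>k :: nat.
       \<exists>x \<in> lp p. lp_norm p x = 1 \<and> supp x \<subseteq> {k..} \<and> pairing (T x) (duality_map p x) = z)"
proof -
  have attained: "\<exists>x \<in> lp p. lp_norm p x = 1 \<and> supp x \<subseteq> {k..} \<and> pairing (T x) (duality_map p x) = z"
    if z: "z \<in> interior (essential_numerical_range p T)" for z and k :: nat
  proof -
    interpret lp_operator p "p / (p - 1)" T z
      using assms by unfold_locales auto
    obtain d where d: "0 < d" "cball z d \<subseteq> essential_numerical_range p T"
      using z mem_interior_cball by blast
    obtain x where x: "finite (supp x)" "supp x \<subseteq> {k..}" "x \<noteq> (\<lambda>j. 0)" "form x x = 0"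
      using isotropic_vector[OF d(2,1)] .
    show ?thesis
      using normalised_attaining_vector[OF lp_finite_support[OF x(1)] x(3,4)] x(2) by (metis order_trans)
  qed
  then have "interior (essential_numerical_range p T) \<subseteq> numerical_range p T"
    unfolding numerical_range_def by fastforce
  with attained show ?thesis by blast
qed

end
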